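(* Let $X$ be an order continuous Banach lattice. The following are equivalent: (1) $X$ is a KB-space; (2) every norm bounded uo-Cauchy net in $X$ is uo-convergent (to an element of $X$); (3) every norm bounded uo-Cauchy sequence in $X$ is uo-convergent (to an element of $X$).
   Context: A Banach lattice is order continuous if every order null net is norm null. It is a KB-space if every norm bounded increasing sequence converges in norm. A net $(x_\alpha)$ in a vector lattice $X$ order converges to $x$ ($x_\alpha\xrightarrow{o}x$) if there is a net $(z_\beta)$ (possibly over a different index set) with $z_\beta\downarrow 0$ such that for every $\beta$ there is $\alpha_0$ with $|x_\alpha-x|\le z_\beta$ for all $\alpha\ge\alpha_0$. The net uo-converges to $x$ if $|x_\alpha-x|\wedge y\xrightarrow{o}0$ for all $y\in X_+$. A net $(x_\alpha)_{\alpha\in\Gamma}$ is uo-Cauchy if the net $(x_\alpha-x_{\alpha'})_{(\alpha,\alpha')\in\Gamma\times\Gamma}$ uo-converges to $0$. *)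

theory Defs
  imports "HOL-Analysis.Analysis" "HOL-Library.Lattice_Algebras"
begin

class vector_lattice = ordered_real_vector + lattice_ab_group_add_abs

class banach_lattice = vector_lattice + banach +
  assumes norm_mono_abs: "\<bar>x\<bar> \<le> \<bar>y\<bar> \<Longrightarrow> norm x \<le> norm y"

text \<open>
  A net is a function restricted to an index set \<open>I\<close> that is directed by a preorder \<open>le\<close>.
\<close>

definition directed_set :: "'i set \<Rightarrow> ('i \<Rightarrow> 'i \<Rightarrow> bool) \<Rightarrow> bool" where
  "directed_set I le \<longleftrightarrow>
     I \<noteq> {} \<and>
     (\<forall>i\<in>I. le i i) \<and>
     (\<forall>i\<in>I. \<forall>j\<in>I. \<forall>k\<in>I. le i j \<longrightarrow> le j k \<longrightarrow> le i k) \<and>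
     (\<forall>i\<in>I. \<forall>j\<in>I. \<exists>k\<in>I. le i k \<and> le j k)"

definition decreases_to_zero ::
    "'j set \<Rightarrow> ('j \<Rightarrow> 'j \<Rightarrow> bool) \<Rightarrow> ('j \<Rightarrow> 'a::vector_lattice) \<Rightarrow> bool" where
  "decreases_to_zero J le z \<longleftrightarrow>
     (\<forall>\<beta>\<in>J. \<forall>\<beta>'\<in>J. le \<beta> \<beta>' \<longrightarrow> z \<beta>' \<le> z \<beta>) \<and>
     (\<forall>\<beta>\<in>J. 0 \<le> z \<beta>) \<and> (\<forall>u. (\<forall>\<beta>\<in>J. u \<le> z \<beta>) \<longrightarrow> u \<le> 0)"

text \<open>
  The index set of the dominating net \<open>z\<close> is drawn from the type \<open>'a\<close> of the vector lattice,
  because HOL cannot quantify existentially over index types. Nothing is lost: a decreasing net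
  can be indexed by its own range (lemma \<open>order_convergesI\<close>).
\<close>

definition order_converges ::
    "'i set \<Rightarrow> ('i \<Rightarrow> 'i \<Rightarrow> bool) \<Rightarrow> ('i \<Rightarrow> 'a::vector_lattice) \<Rightarrow> 'a \<Rightarrow> bool" where
  "order_converges I le x l \<longleftrightarrow>
     (\<exists>(J :: 'a set) le' z. directed_set J le' \<and> decreases_to_zero J le' z \<and>
        (\<forall>\<beta>\<in>J. \<exists>\<alpha>\<^sub>0\<in>I. \<forall>\<alpha>\<in>I. le \<alpha>\<^sub>0 \<alpha> \<longrightarrow> \<bar>x \<alpha> - l\<bar> \<le> z \<beta>))"

lemma order_convergesI:
  fixes J :: "'j set" and z :: "'j \<Rightarrow> 'a::vector_lattice"
  assumes J: "directed_set J le'" and z: "decreases_to_zero J le' z"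
    and dom: "\<And>\<beta>. \<beta> \<in> J \<Longrightarrow> \<exists>\<alpha>\<^sub>0\<in>I. \<forall>\<alpha>\<in>I. le \<alpha>\<^sub>0 \<alpha> \<longrightarrow> \<bar>x \<alpha> - l\<bar> \<le> z \<beta>"
  shows "order_converges I le x l"
proof -
  have "directed_set (z ` J) (\<ge>)"
    unfolding directed_set_def
  proof (intro conjI)
    show "z ` J \<noteq> {}" using J by (auto simp: directed_set_def)
    show "\<forall>i\<in>z ` J. \<forall>j\<in>z ` J. \<exists>k\<in>z ` J. k \<le> i \<and> k \<le> j"
    proof clarify
      fix a b assume ab: "a \<in> J" "b \<in> J"
      then obtain c where "c \<in> J" "le' a c" "le' b c"
        using J unfolding directed_set_def by blast
      then show "\<exists>k\<in>z ` J. k \<le> z a \<and> k \<le> z b"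
        using z ab unfolding decreases_to_zero_def by blast
    qed
  qed auto
  moreover have "decreases_to_zero (z ` J) (\<ge>) id"
    using z unfolding decreases_to_zero_def by auto
  moreover have "\<forall>\<beta>\<in>z ` J. \<exists>\<alpha>\<^sub>0\<in>I. \<forall>\<alpha>\<in>I. le \<alpha>\<^sub>0 \<alpha> \<longrightarrow> \<bar>x \<alpha> - l\<bar> \<le> id \<beta>"
    using dom by auto
  ultimately show ?thesis unfolding order_converges_def by blast
qed

definition uo_converges ::
    "'i set \<Rightarrow> ('i \<Rightarrow> 'i \<Rightarrow> bool) \<Rightarrow> ('i \<Rightarrow> 'a::vector_lattice) \<Rightarrow> 'a \<Rightarrow> bool" where
  "uo_converges I le x l \<longleftrightarrow>
     (\<forall>y\<ge>0. order_converges I le (\<lambda>\<alpha>. inf \<bar>x \<alpha> - l\<bar> y) 0)"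

definition uo_Cauchy ::
    "'i set \<Rightarrow> ('i \<Rightarrow> 'i \<Rightarrow> bool) \<Rightarrow> ('i \<Rightarrow> 'a::vector_lattice) \<Rightarrow> bool" where
  "uo_Cauchy I le x \<longleftrightarrow>
     uo_converges (I \<times> I) (rel_prod le le) (\<lambda>(\<alpha>, \<alpha>'). x \<alpha> - x \<alpha>') 0"

definition norm_null ::
    "'i set \<Rightarrow> ('i \<Rightarrow> 'i \<Rightarrow> bool) \<Rightarrow> ('i \<Rightarrow> 'a::real_normed_vector) \<Rightarrow> bool" where
  "norm_null I le x \<longleftrightarrow> (\<forall>e>0. \<exists>\<alpha>\<^sub>0\<in>I. \<forall>\<alpha>\<in>I. le \<alpha>\<^sub>0 \<alpha> \<longrightarrow> norm (x \<alpha>) < e)"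

text \<open>
  Nets indexed by sets of elements of \<open>'a\<close> suffice here: the property then follows for nets over
  every index type (lemma \<open>order_continuousD\<close>).
\<close>

definition order_continuous :: "'a::banach_lattice itself \<Rightarrow> bool" where
  "order_continuous _ \<longleftrightarrow>
     (\<forall>(I :: 'a set) le (x :: 'a \<Rightarrow> 'a).
        directed_set I le \<longrightarrow> order_converges I le x 0 \<longrightarrow> norm_null I le x)"

lemma order_continuousD:
  fixes I :: "'i set" and x :: "'i \<Rightarrow> 'a::banach_lattice"
  assumes oc: "order_continuous TYPE('a)" and x: "order_converges I le x 0"
  shows "norm_null I le x"
proof -
  from x obtain J :: "'a set" and le' z where J: "directed_set J le'"
    and z: "decreases_to_zero J le' z"
    and dom: "\<forall>\<beta>\<in>J. \<exists>\<alpha>\<^sub>0\<in>I. \<forall>\<alpha>\<in>I. le \<alpha>\<^sub>0 \<alpha> \<longrightarrow> \<bar>x \<alpha> - 0\<bar> \<le> z \<beta>"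
    unfolding order_converges_def by blast
  have "order_converges J le' z 0"
  proof (rule order_convergesI[OF J z])
    fix \<beta> assume "\<beta> \<in> J"
    then show "\<exists>\<alpha>\<^sub>0\<in>J. \<forall>\<alpha>\<in>J. le' \<alpha>\<^sub>0 \<alpha> \<longrightarrow> \<bar>z \<alpha> - 0\<bar> \<le> z \<beta>"
      using z unfolding decreases_to_zero_def by (intro bexI[of _ \<beta>]) auto
  qed
  with oc J have nz: "norm_null J le' z"
    unfolding order_continuous_def by blast
  show ?thesis
    unfolding norm_null_def
  proof (intro allI impI)
    fix e :: real assume "e > 0"
    with nz obtain \<beta> where \<beta>: "\<beta> \<in> J" and "\<forall>\<alpha>\<in>J. le' \<beta> \<alpha> \<longrightarrow> norm (z \<alpha>) < e"
      unfolding norm_null_def by blast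
    then have zb: "norm (z \<beta>) < e" using J unfolding directed_set_def by blast
    from dom \<beta> obtain \<alpha>\<^sub>0 where a0: "\<alpha>\<^sub>0 \<in> I" "\<forall>\<alpha>\<in>I. le \<alpha>\<^sub>0 \<alpha> \<longrightarrow> \<bar>x \<alpha>\<bar> \<le> z \<beta>"
      by auto
    have "norm (x \<alpha>) < e" if "\<bar>x \<alpha>\<bar> \<le> z \<beta>" for \<alpha>
    proof -
      have "\<bar>x \<alpha>\<bar> \<le> \<bar>z \<beta>\<bar>" using that abs_ge_self order_trans by blast
      then show ?thesis using norm_mono_abs zb by (meson le_less_trans)
    qed
    with a0 show "\<exists>\<alpha>\<^sub>0\<in>I. \<forall>\<alpha>\<in>I. le \<alpha>\<^sub>0 \<alpha> \<longrightarrow> norm (x \<alpha>) < e" by blast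
  qed
qed

definition KB_space :: "'a::banach_lattice itself \<Rightarrow> bool" where
  "KB_space _ \<longleftrightarrow>
     (\<forall>x :: nat \<Rightarrow> 'a. bounded (range x) \<longrightarrow> incseq x \<longrightarrow> convergent x)"

end

theory Submission
  imports Defs
begin

text \<open>
  Order continuity links order and norm in two ways: order convergence implies norm convergence to
  the same limit, and increasing sequences that are bounded in order converge in norm
  (\<open>order_continuous_bounded_incseq_convergent\<close>).

  Let the space have the KB property and let \<open>x\<close> be a norm bounded uo-Cauchy net. As the positive
  and the negative parts of \<open>x\<close> are again uo-Cauchy, \<open>x\<close> may be taken nonnegative. For each
  \<open>y \<ge> 0\<close> the truncations \<open>inf (x i) y\<close> are order Cauchy, hence norm Cauchy, and their norm limit
  \<open>L y\<close> is also their order limit (\<open>order_Cauchy_imp_order_converges\<close>). The elements \<open>L y\<close> increase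
  with \<open>y\<close> and inherit the norm bound of \<open>x\<close>, so by the KB property they converge in norm to some
  \<open>l\<close>, and \<open>L y = inf l y\<close>. The inequality \<open>inf \<bar>a - l\<bar> y \<le> \<bar>inf a (l + y) - l\<bar>\<close> then turns the
  order convergence of \<open>inf (x i) (l + y)\<close> to \<open>inf l (l + y) = l\<close> into uo-convergence of \<open>x\<close> to
  \<open>l\<close>.

  Conversely, let every norm bounded uo-Cauchy sequence uo-converge, and let \<open>x\<close> be increasing and
  norm bounded. The point is that \<open>x\<close> is uo-Cauchy (\<open>norm_bounded_incseq_uo_Cauchy\<close>). Let \<open>V m\<close> be
  the limit of \<open>inf (x n - x m) y\<close> in \<open>n\<close>. If \<open>0 \<le> v \<le> V m\<close> for all \<open>m\<close>, then \<open>x\<close> still has to grow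
  by almost \<open>v\<close> after every index. Repeating this \<open>k\<close> times, \<open>x\<close> grows by almost \<open>k v\<close>, so norm
  boundedness forces \<open>v = 0\<close> (\<open>norm_bounded_climb_eq_zero\<close>). Hence \<open>V\<close> decreases to zero, and it
  dominates the truncated differences. The uo-limit of \<open>x\<close> is then an upper bound, and order
  continuity makes it the norm limit.

  The condition on nets implies the one on sequences because an infinite index type contains a copy of the natural numbers.
\<close>

section \<open>Lattice-ordered groups\<close>

lemma abs_diff_leI:
  fixes a b c :: "'a::lattice_ab_group_add_abs"
  assumes "a \<le> b + c" "b \<le> a + c"
  shows "\<bar>a - b\<bar> \<le> c"
proof (rule abs_leI)
  show "a - b \<le> c" using assms(1) by (simp only: diff_le_eq add.commute)
  show "- (a - b) \<le> c" using assms(2) by (simp only: minus_diff_eq diff_le_eq add.commute)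
qed

lemma abs_inf_diff_le:
  fixes a b y :: "'a::lattice_ab_group_add_abs"
  shows "\<bar>inf a y - inf b y\<bar> \<le> \<bar>a - b\<bar>"
proof -
  have *: "inf p y \<le> inf q y + \<bar>p - q\<bar>" for p q :: 'a
  proof -
    have "p \<le> q + \<bar>p - q\<bar>"
      using abs_ge_self[of "p - q"] by (simp add: algebra_simps)
    then have "inf p y \<le> inf (q + \<bar>p - q\<bar>) (y + \<bar>p - q\<bar>)"
      by (intro inf_mono) auto
    then show ?thesis by (simp add: add_inf_distrib_right)
  qed
  show ?thesis
    using *[of a b] *[of b a] by (intro abs_diff_leI) (simp_all only: abs_minus_commute)
qed

lemma abs_inf_diff_le_inf:
  fixes a b y :: "'a::lattice_ab_group_add_abs"
  assumes "0 \<le> a" "0 \<le> b" "0 \<le> y"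
  shows "\<bar>inf a y - inf b y\<bar> \<le> (inf \<bar>a - b\<bar> y)"
proof (rule inf_greatest[OF abs_inf_diff_le])
  have *: "inf p y \<le> inf q y + y" if "0 \<le> q" for p q :: 'a
  proof -
    have "inf p y \<le> 0 + y" by simp
    also have "\<dots> \<le> inf q y + y" using that assms by (intro add_right_mono) simp
    finally show ?thesis .
  qed
  show "\<bar>inf a y - inf b y\<bar> \<le> y"
    using *[of b a] *[of a b] assms by (intro abs_diff_leI) blast+
qed

text \<open>
  This is a converse of the previous estimate: truncating \<open>a\<close> at the level \<open>b + y\<close> keeps enough
  of it to control the truncated distance of \<open>a\<close> and \<open>b\<close>.
\<close>

lemma inf_abs_diff_le_abs_inf_diff:
  fixes a b y :: "'a::lattice_ab_group_add_abs"
  shows "(inf \<bar>a - b\<bar> y) \<le> \<bar>inf a (b + y) - b\<bar>"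
proof -
  define c where "c = a - b"
  define t where "t = \<bar>inf c y\<bar>"
  (* Since inf + sup = +, the claim inf |c| y \<le> t says that |c| is at most the following bound. *)
  define r where "r = t - y + sup \<bar>c\<bar> y"
  have move: "p + q - s \<le> t' \<longleftrightarrow> p \<le> t' - q + s" for p q s t' :: 'a
    by (simp add: algebra_simps)
  have "inf c y \<le> t" unfolding t_def by (rule abs_ge_self)
  then have "c + y - sup c y \<le> t"
    by (simp only: add_eq_inf_sup[of c y] add_diff_cancel_left')
  then have "c \<le> t - y + sup c y" by (simp only: move)
  also have "\<dots> \<le> r"
    unfolding r_def by (intro add_left_mono sup_mono abs_ge_self order_refl)
  finally have 1: "c \<le> r" .
  have "- c \<le> - inf c y" by simp
  also have "\<dots> \<le> t" unfolding t_def by (rule abs_ge_minus_self)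
  also have "t \<le> r" by (simp add: r_def algebra_simps)
  finally have "- c \<le> r" .
  with 1 have "\<bar>c\<bar> \<le> r" by (rule abs_leI)
  then have "\<bar>c\<bar> + y - sup \<bar>c\<bar> y \<le> t" by (simp only: r_def move)
  then have "(inf \<bar>c\<bar> y) \<le> t" 
    by (simp only: add_eq_inf_sup[of "\<bar>c\<bar>" y] add_diff_cancel_left')
  moreover have "inf a (b + y) - b = inf c y"
    using add_inf_distrib_right[of a "b + y" "- b"] by (simp add: c_def)
  ultimately show ?thesis by (simp add: c_def t_def)
qed

lemma inf_abs_add_le:
  fixes u v y :: "'a::lattice_ab_group_add_abs"
  assumes "0 \<le> y"
  shows "(inf \<bar>u + v\<bar> y) \<le> (inf \<bar>u\<bar> y) + (inf \<bar>v\<bar> y)"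
proof -
  let ?m = "inf \<bar>u + v\<bar> y"
  have "?m \<le> \<bar>u\<bar> + \<bar>v\<bar>" by (rule order_trans[OF inf_le1 abs_triangle_ineq])
  moreover have "?m \<le> \<bar>u\<bar> + y" using add_mono[of 0 "\<bar>u\<bar>" ?m y] by simp
  moreover have "?m \<le> y + \<bar>v\<bar>" using add_mono[of ?m y 0 "\<bar>v\<bar>"] by simp
  moreover have "?m \<le> y + y" using add_mono[of ?m y 0 y] assms by simp
  ultimately show ?thesis by (simp add: add_inf_distrib_left add_inf_distrib_right)
qed

lemma abs_pprt_diff_le:
  fixes a b :: "'a::lattice_ab_group_add_abs"
  shows "\<bar>pprt a - pprt b\<bar> \<le> \<bar>a - b\<bar>"
proof -
  have *: "pprt p \<le> pprt q + \<bar>p - q\<bar>" for p q :: 'a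
  proof -
    have "p \<le> q + \<bar>p - q\<bar>"
      using abs_ge_self[of "p - q"] by (simp add: algebra_simps)
    then have "sup p 0 \<le> sup (q + \<bar>p - q\<bar>) (0 + \<bar>p - q\<bar>)"
      by (intro sup_mono) auto
    then show ?thesis by (simp add: pprt_def add_sup_distrib_right)
  qed
  show ?thesis
    using *[of a b] *[of b a] by (intro abs_diff_leI) (simp_all only: abs_minus_commute)
qed

lemma pprt_add_le:
  fixes a b :: "'a::lattice_ab_group_add_abs"
  shows "pprt (a + b) \<le> pprt a + pprt b"
  unfolding pprt_def using add_mono[of a "sup a 0" b "sup b 0"] by simp

section \<open>Norm and order in a Banach lattice\<close>

lemma norm_mono_nonneg:
  fixes a b :: "'a::banach_lattice"
  assumes "0 \<le> a" "a \<le> b"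
  shows "norm a \<le> norm b"
  using assms by (intro norm_mono_abs) (simp add: order_trans[OF assms])

lemma norm_abs_eq [simp]:
  fixes a :: "'a::banach_lattice"
  shows "norm \<bar>a\<bar> = norm a"
  by (intro antisym norm_mono_abs) simp_all

lemma norm_pprt_le:
  fixes a b :: "'a::banach_lattice"
  assumes "a \<le> b"
  shows "norm (pprt a) \<le> norm b"
proof -
  have "a \<le> \<bar>b\<bar>" using assms abs_ge_self order_trans by blast
  then have "pprt a \<le> \<bar>b\<bar>" by (simp add: pprt_def)
  then show ?thesis using norm_mono_nonneg[of "pprt a" "\<bar>b\<bar>"] by simp
qed

text \<open>
  The positive cone is norm closed. In this form no limit has to be named.
\<close>

lemma le_if_approx_le:
  fixes a b :: "'a::banach_lattice"
  assumes "\<And>e. e > 0 \<Longrightarrow> \<exists>c. a \<le> b + c \<and> norm c < e"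
  shows "a \<le> b"
proof -
  have "norm (pprt (a - b)) \<le> 0 + e" if "e > 0" for e
  proof -
    obtain c where "a \<le> b + c" "norm c < e" using assms[OF \<open>e > 0\<close>] by blast
    then have "a - b \<le> c" by (simp add: algebra_simps)
    from norm_pprt_le[OF this] \<open>norm c < e\<close> show ?thesis by simp
  qed
  then have "norm (pprt (a - b)) \<le> 0" by (rule field_le_epsilon)
  then have "a - b \<le> 0" using le_zero_iff_zero_pprt[of "a - b"] by simp
  then show ?thesis by simp
qed

lemma le_zero_if_multiples_bounded:
  fixes a b :: "'a::banach_lattice"
  assumes "\<And>k::nat. real k *\<^sub>R a \<le> b"
  shows "a \<le> 0"
proof (rule le_if_approx_le)
  fix e :: real assume "e > 0"
  then obtain k :: nat where k: "norm b / e < real k" using reals_Archimedean2 by blast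
  then have pos: "0 < real k" using \<open>e > 0\<close> by (meson divide_nonneg_pos le_less_trans norm_ge_zero)
  have "inverse (real k) *\<^sub>R (real k *\<^sub>R a) \<le> inverse (real k) *\<^sub>R b"
    using assms[of k] pos by (intro scaleR_left_mono) auto
  then have "a \<le> 0 + inverse (real k) *\<^sub>R b" using pos by simp
  moreover have "norm (inverse (real k) *\<^sub>R b) < e"
    using k pos \<open>e > 0\<close> by (simp add: field_simps)
  ultimately show "\<exists>c. a \<le> 0 + c \<and> norm c < e" by blast
qed

lemma incseq_le_norm_limit:
  fixes x :: "nat \<Rightarrow> 'a::banach_lattice"
  assumes "incseq x" "x \<longlonglongrightarrow> l"
  shows "x n \<le> l"
proof (rule le_if_approx_le)
  fix e :: real assume "e > 0"
  then obtain N where N: "\<And>m. m \<ge> N \<Longrightarrow> norm (x m - l) < e"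
    using assms(2) by (metis LIMSEQ_iff)
  have "x n \<le> l + (x (max n N) - l)" using incseqD[OF assms(1), of n "max n N"] by simp
  moreover have "norm (x (max n N) - l) < e" by (rule N) simp
  ultimately show "\<exists>c. x n \<le> l + c \<and> norm c < e" by blast
qed

section \<open>Nets\<close>

lemma directed_set_ub:
  assumes "directed_set I le" "i \<in> I" "j \<in> I"
  obtains k where "k \<in> I" "le i k" "le j k"
  using assms unfolding directed_set_def by blast

lemma directed_set_refl:
  assumes "directed_set I le" "i \<in> I"
  shows "le i i"
  using assms unfolding directed_set_def by blast

lemma directed_set_trans:
  assumes "directed_set I le" "le i j" "le j k" "i \<in> I" "j \<in> I" "k \<in> I"
  shows "le i k"
  using assms unfolding directed_set_def by blast

lemma directed_set_Times:
  assumes I: "directed_set I le" and J: "directed_set J le'"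
  shows "directed_set (I \<times> J) (rel_prod le le')"
  unfolding directed_set_def
proof (intro conjI ballI impI)
  show "I \<times> J \<noteq> {}" using I J unfolding directed_set_def by blast
  fix p assume p: "p \<in> I \<times> J"
  show "rel_prod le le' p p"
    using directed_set_refl[OF I] directed_set_refl[OF J] p by (auto simp: rel_prod_sel)
  fix q assume q: "q \<in> I \<times> J"
  show "\<exists>k\<in>I \<times> J. rel_prod le le' p k \<and> rel_prod le le' q k"
  proof -
    obtain a where "a \<in> I" "le (fst p) a" "le (fst q) a"
      using directed_set_ub[OF I] p q by (metis mem_Times_iff)
    moreover obtain b where "b \<in> J" "le' (snd p) b" "le' (snd q) b"
      using directed_set_ub[OF J] p q by (metis mem_Times_iff)
    ultimately show ?thesis by (intro bexI[of _ "(a, b)"]) (auto simp: rel_prod_sel)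
  qed
  fix r assume "r \<in> I \<times> J" "rel_prod le le' p q" "rel_prod le le' q r"
  with p q show "rel_prod le le' p r"
    unfolding rel_prod_sel mem_Times_iff
    using directed_set_trans[OF I, of "fst p" "fst q" "fst r"]
      directed_set_trans[OF J, of "snd p" "snd q" "snd r"] by blast
qed

lemma directed_set_nat: "directed_set (UNIV :: nat set) (\<le>)"
  unfolding directed_set_def by simp (meson max.cobounded1 max.cobounded2)

lemma order_converges_dominated:
  assumes "order_converges I le x l" "\<And>i. i \<in> I \<Longrightarrow> \<bar>x' i - l'\<bar> \<le> \<bar>x i - l\<bar>"
  shows "order_converges I le x' l'"
  using assms unfolding order_converges_def by (meson order_trans)

lemma order_converges_add_null:
  fixes x x' :: "'i \<Rightarrow> 'a::vector_lattice"
  assumes I: "directed_set I le"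
    and x: "order_converges I le x 0" and x': "order_converges I le x' 0"
  shows "order_converges I le (\<lambda>i. x i + x' i) 0"
proof -
  from x obtain J :: "'a set" and lJ z where J: "directed_set J lJ" "decreases_to_zero J lJ z"
    and z: "\<forall>\<beta>\<in>J. \<exists>\<alpha>\<^sub>0\<in>I. \<forall>\<alpha>\<in>I. le \<alpha>\<^sub>0 \<alpha> \<longrightarrow> \<bar>x \<alpha> - 0\<bar> \<le> z \<beta>"
    unfolding order_converges_def by blast
  from x' obtain K :: "'a set" and lK w where K: "directed_set K lK" "decreases_to_zero K lK w"
    and w: "\<forall>\<beta>\<in>K. \<exists>\<alpha>\<^sub>0\<in>I. \<forall>\<alpha>\<in>I. le \<alpha>\<^sub>0 \<alpha> \<longrightarrow> \<bar>x' \<alpha> - 0\<bar> \<le> w \<beta>"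
    unfolding order_converges_def by blast
  let ?s = "\<lambda>p. z (fst p) + w (snd p)"
  show ?thesis
  proof (rule order_convergesI[where z = ?s])
    show "directed_set (J \<times> K) (rel_prod lJ lK)" by (rule directed_set_Times[OF J(1) K(1)])
    have "u \<le> 0" if u: "\<forall>p\<in>J \<times> K. u \<le> ?s p" for u
    proof -
      have "u \<le> z b" if "b \<in> J" for b
      proof -
        have "\<forall>c\<in>K. u - z b \<le> w c" using u that by (auto simp: algebra_simps)
        then have "u - z b \<le> 0" using K(2) unfolding decreases_to_zero_def by blast
        then show ?thesis by simp
      qed
      then show ?thesis using J(2) unfolding decreases_to_zero_def by blast
    qed
    then show "decreases_to_zero (J \<times> K) (rel_prod lJ lK) ?s"
      using J(2) K(2) unfolding decreases_to_zero_def
      by (auto simp: rel_prod_sel intro!: add_mono)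
    fix p assume "p \<in> J \<times> K"
    then have p: "fst p \<in> J" "snd p \<in> K" by auto
    obtain a where a: "a \<in> I" "\<forall>i\<in>I. le a i \<longrightarrow> \<bar>x i\<bar> \<le> z (fst p)"
      using bspec[OF z p(1)] by auto
    obtain b where b: "b \<in> I" "\<forall>i\<in>I. le b i \<longrightarrow> \<bar>x' i\<bar> \<le> w (snd p)"
      using bspec[OF w p(2)] by auto
    obtain c where c: "c \<in> I" "le a c" "le b c"
      using I a(1) b(1) unfolding directed_set_def by blast
    have "\<bar>x i + x' i\<bar> \<le> ?s p" if "i \<in> I" "le c i" for i
    proof -
      have "le a i" "le b i" using I a(1) b(1) c that unfolding directed_set_def by blast+
      then show ?thesis
        using a b that by (intro order_trans[OF abs_triangle_ineq] add_mono) auto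
    qed
    with c show "\<exists>\<alpha>\<^sub>0\<in>I. \<forall>\<alpha>\<in>I. le \<alpha>\<^sub>0 \<alpha> \<longrightarrow> \<bar>x \<alpha> + x' \<alpha> - 0\<bar> \<le> ?s p" by auto
  qed
qed

lemma uo_converges_diff:
  fixes x x' :: "'i \<Rightarrow> 'a::vector_lattice"
  assumes I: "directed_set I le"
    and x: "uo_converges I le x l" and x': "uo_converges I le x' l'"
  shows "uo_converges I le (\<lambda>i. x i - x' i) (l - l')"
  unfolding uo_converges_def
proof (intro allI impI)
  fix y :: 'a assume y: "0 \<le> y"
  have *: "order_converges I le (\<lambda>i. (inf \<bar>x i - l\<bar> y) + (inf \<bar>x' i - l'\<bar> y)) 0"
    using x[unfolded uo_converges_def, rule_format, OF y]
      x'[unfolded uo_converges_def, rule_format, OF y]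
    by (rule order_converges_add_null[OF I])
  show "order_converges I le (\<lambda>i. inf \<bar>x i - x' i - (l - l')\<bar> y) 0"
  proof (rule order_converges_dominated[OF *])
    fix i
    have "(inf \<bar>(x i - l) + - (x' i - l')\<bar> y) \<le> (inf \<bar>x i - l\<bar> y) + (inf \<bar>- (x' i - l')\<bar> y)"
      by (rule inf_abs_add_le[OF y])
    moreover have "(x i - l) + - (x' i - l') = x i - x' i - (l - l')" by simp
    ultimately have le: "(inf \<bar>x i - x' i - (l - l')\<bar> y) \<le> (inf \<bar>x i - l\<bar> y) + (inf \<bar>x' i - l'\<bar> y)"
      by (simp only: abs_minus_cancel)
    have "0 \<le> inf \<bar>x i - x' i - (l - l')\<bar> y" using y by simp
    then show "\<bar>(inf \<bar>x i - x' i - (l - l')\<bar> y) - 0\<bar>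
        \<le> \<bar>(inf \<bar>x i - l\<bar> y) + (inf \<bar>x' i - l'\<bar> y) - 0\<bar>"
      using le order_trans[OF _ le] by (simp only: diff_0_right abs_of_nonneg)
  qed
qed

lemma uo_Cauchy_dominated:
  assumes "uo_Cauchy I le x"
    and "\<And>i j. i \<in> I \<Longrightarrow> j \<in> I \<Longrightarrow> \<bar>x' i - x' j\<bar> \<le> \<bar>x i - x j\<bar>"
  shows "uo_Cauchy I le x'"
  unfolding uo_Cauchy_def uo_converges_def
proof (intro allI impI)
  fix y :: 'b assume y: "0 \<le> y"
  with assms(1) have *: "order_converges (I \<times> I) (rel_prod le le)
      (\<lambda>p. inf \<bar>(case p of (i, j) \<Rightarrow> x i - x j) - 0\<bar> y) 0"
    unfolding uo_Cauchy_def uo_converges_def by blast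
  show "order_converges (I \<times> I) (rel_prod le le)
      (\<lambda>p. inf \<bar>(case p of (i, j) \<Rightarrow> x' i - x' j) - 0\<bar> y) 0"
    by (rule order_converges_dominated[OF *]) (use y assms(2) in \<open>auto intro: le_infI1\<close>)
qed

lemma order_converges_imp_norm_null:
  fixes x :: "'i \<Rightarrow> 'a::banach_lattice"
  assumes "order_continuous TYPE('a)" "order_converges I le x l"
  shows "norm_null I le (\<lambda>i. x i - l)"
  by (rule order_continuousD[OF assms(1)], rule order_converges_dominated[OF assms(2)]) simp

lemma norm_null_const:
  fixes a :: "'a::real_normed_vector"
  assumes "directed_set I le" "norm_null I le (\<lambda>_. a)"
  shows "a = 0"
proof (rule ccontr)
  assume "a \<noteq> 0"
  then obtain i where "i \<in> I" "\<forall>j\<in>I. le i j \<longrightarrow> norm a < norm a"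
    using assms(2) unfolding norm_null_def by (meson zero_less_norm_iff)
  then show False using assms(1) unfolding directed_set_def by blast
qed

lemma norm_null_dominated:
  assumes "norm_null I le x" "\<And>i. i \<in> I \<Longrightarrow> norm (x' i) \<le> norm (x i)"
  shows "norm_null I le x'"
  using assms unfolding norm_null_def by (meson le_less_trans)

lemma norm_null_diff:
  assumes I: "directed_set I le" and x: "norm_null I le x" and x': "norm_null I le x'"
  shows "norm_null I le (\<lambda>i. x i - x' i)"
  unfolding norm_null_def
proof (intro allI impI)
  fix e :: real assume "e > 0"
  then have e: "e / 2 > 0" by simp
  obtain a where a: "a \<in> I" "\<forall>i\<in>I. le a i \<longrightarrow> norm (x i) < e / 2"
    using x e unfolding norm_null_def by blast
  obtain b where b: "b \<in> I" "\<forall>i\<in>I. le b i \<longrightarrow> norm (x' i) < e / 2"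
    using x' e unfolding norm_null_def by blast
  obtain c where c: "c \<in> I" "le a c" "le b c"
    using I a(1) b(1) unfolding directed_set_def by blast
  have "norm (x i - x' i) < e" if "i \<in> I" "le c i" for i
  proof -
    have "le a i" "le b i" using I a(1) b(1) c that unfolding directed_set_def by blast+
    then have "norm (x i) < e / 2" "norm (x' i) < e / 2" using a b that by auto
    then show ?thesis using norm_triangle_ineq4[of "x i" "x' i"] by linarith
  qed
  with c show "\<exists>c\<in>I. \<forall>i\<in>I. le c i \<longrightarrow> norm (x i - x' i) < e" by blast
qed

lemma norm_null_limit_unique:
  assumes I: "directed_set I le"
    and "norm_null I le (\<lambda>i. x i - a)" "norm_null I le (\<lambda>i. x i - b)"
  shows "a = b"
proof -
  have "norm_null I le (\<lambda>i. (x i - a) - (x i - b))" by (rule norm_null_diff[OF assms])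
  then have "norm_null I le (\<lambda>i. b - a)" by simp
  then show ?thesis using norm_null_const[OF I] by force
qed

text \<open>
  Completeness speaks of sequences. One index \<open>c n\<close> per accuracy \<open>1 / Suc n\<close> is enough: \<open>c m\<close> and
  \<open>c n\<close> need not be comparable, but a common upper bound compares their values.
\<close>

lemma Cauchy_net_norm_converges:
  fixes x :: "'i \<Rightarrow> 'a::banach"
  assumes I: "directed_set I le"
    and Cauchy: "\<And>e. e > 0 \<Longrightarrow> \<exists>i\<in>I. \<forall>j\<in>I. le i j \<longrightarrow> norm (x j - x i) < e"
  shows "\<exists>l. norm_null I le (\<lambda>i. x i - l)"
proof -
  have "\<forall>n. \<exists>i\<in>I. \<forall>j\<in>I. le i j \<longrightarrow> norm (x j - x i) < 1 / Suc n"
    using Cauchy by simp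
  then obtain c where c: "\<And>n. c n \<in> I"
    "\<And>n j. j \<in> I \<Longrightarrow> le (c n) j \<Longrightarrow> norm (x j - x (c n)) < 1 / Suc n"
    by metis
  have dist: "norm (x (c m) - x (c n)) < 1 / Suc m + 1 / Suc n" for m n
  proof -
    obtain k where k: "k \<in> I" "le (c m) k" "le (c n) k"
      using I c(1) unfolding directed_set_def by blast
    have "norm (x (c m) - x (c n)) \<le> norm (x k - x (c m)) + norm (x k - x (c n))"
      using norm_triangle_ineq4[of "x k - x (c n)" "x k - x (c m)"] by simp
    then show ?thesis using c(2)[of k m] c(2)[of k n] k by linarith
  qed
  have small: "\<exists>N. \<forall>n\<ge>N. 1 / Suc n < e" if "e > 0" for e :: real
  proof -
    obtain N where N: "1 / Suc N < e" using nat_approx_posE[OF \<open>e > 0\<close>] by blast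
    have "1 / Suc n < e" if "n \<ge> N" for n
      using frac_le[of 1 1 "Suc N" "Suc n"] N that by simp
    then show ?thesis by blast
  qed
  have "Cauchy (\<lambda>n. x (c n))"
  proof (rule CauchyI)
    fix e :: real assume "e > 0"
    then obtain N where "\<forall>n\<ge>N. 1 / Suc n < e / 2" using small[of "e / 2"] by auto
    then have s: "1 / Suc m < e / 2" if "m \<ge> N" for m
      using that by blast
    have "norm (x (c m) - x (c n)) < e" if "m \<ge> N" "n \<ge> N" for m n
      using dist[of m n] s[OF that(1)] s[OF that(2)] by linarith
    then show "\<exists>M. \<forall>m\<ge>M. \<forall>n\<ge>M. norm (x (c m) - x (c n)) < e" by blast
  qed
  then obtain l where l: "(\<lambda>n. x (c n)) \<longlonglongrightarrow> l"
    using Cauchy_convergent convergent_def by blast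
  have "norm_null I le (\<lambda>i. x i - l)"
    unfolding norm_null_def
  proof (intro allI impI)
    fix e :: real assume "e > 0"
    then have e: "e / 2 > 0" by simp
    obtain N where N: "\<forall>n\<ge>N. 1 / Suc n < e / 2" using small[OF e] by blast
    obtain M where M: "\<forall>n\<ge>M. norm (x (c n) - l) < e / 2"
      using LIMSEQ_D[OF l e] by blast
    define n where "n = max N M"
    have "norm (x i - l) < e" if i: "i \<in> I" "le (c n) i" for i
    proof -
      have "norm (x i - l) \<le> norm (x i - x (c n)) + norm (x (c n) - l)"
        using norm_triangle_ineq[of "x i - x (c n)" "x (c n) - l"] by simp
      moreover have "1 / Suc n < e / 2" "norm (x (c n) - l) < e / 2"
        using N M unfolding n_def by (meson max.cobounded1 max.cobounded2)+
      ultimately show ?thesis using c(2)[OF i] by linarith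
    qed
    with c(1) show "\<exists>a\<in>I. \<forall>i\<in>I. le a i \<longrightarrow> norm (x i - l) < e" by blast
  qed
  then show ?thesis ..
qed

section \<open>From the KB property to uo-completeness\<close>

text \<open>
  The same net that dominates the differences \<open>u i - u j\<close> also dominates the distances to the
  limit: order continuity makes the net norm Cauchy, and letting \<open>j\<close> run to the norm limit
  preserves the estimates, as the cone is closed.
\<close>

lemma order_Cauchy_imp_order_converges:
  fixes u :: "'i \<Rightarrow> 'a::banach_lattice"
  assumes oc: "order_continuous TYPE('a)" and I: "directed_set I le"
    and u: "order_converges (I \<times> I) (rel_prod le le) (\<lambda>(i, j). u i - u j) 0"
  shows "\<exists>l. order_converges I le u l"
proof -
  have nn: "norm_null (I \<times> I) (rel_prod le le) (\<lambda>(i, j). u i - u j)"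
    by (rule order_continuousD[OF oc u])
  have "\<exists>l. norm_null I le (\<lambda>i. u i - l)"
  proof (rule Cauchy_net_norm_converges[OF I])
    fix e :: real assume "e > 0"
    then obtain a b where ab: "a \<in> I" "b \<in> I"
      "\<forall>p\<in>I \<times> I. rel_prod le le (a, b) p \<longrightarrow> norm (case p of (i, j) \<Rightarrow> u i - u j) < e"
      using nn unfolding norm_null_def by blast
    obtain c where c: "c \<in> I" "le a c" "le b c" using directed_set_ub[OF I ab(1,2)] .
    have "norm (u j - u c) < e" if j: "j \<in> I" "le c j" for j
    proof -
      have "le a j" using directed_set_trans[OF I c(2) j(2)] ab(1) c(1) j(1) by blast
      then show ?thesis using ab(3)[rule_format, of "(j, c)"] c j by simp
    qed
    with c(1) show "\<exists>i\<in>I. \<forall>j\<in>I. le i j \<longrightarrow> norm (u j - u i) < e" by blast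
  qed
  then obtain l where l: "norm_null I le (\<lambda>i. u i - l)" ..
  obtain J :: "'a set" and le' z where J: "directed_set J le'" "decreases_to_zero J le' z"
    and z: "\<forall>b\<in>J. \<exists>a\<in>I \<times> I. \<forall>p\<in>I \<times> I. rel_prod le le a p \<longrightarrow>
      \<bar>(case p of (i, j) \<Rightarrow> u i - u j) - 0\<bar> \<le> z b"
    using u unfolding order_converges_def by blast
  have "order_converges I le u l"
  proof (rule order_convergesI[OF J])
    fix b assume "b \<in> J"
    then obtain a a' where a: "a \<in> I" "a' \<in> I" "\<forall>p\<in>I \<times> I. rel_prod le le (a, a') p \<longrightarrow>
      \<bar>(case p of (i, j) \<Rightarrow> u i - u j) - 0\<bar> \<le> z b"
      using z by blast
    obtain c where c: "c \<in> I" "le a c" "le a' c" using directed_set_ub[OF I a(1,2)] .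
    have "\<bar>u i - l\<bar> \<le> z b" if i: "i \<in> I" "le c i" for i
    proof (rule le_if_approx_le)
      fix e :: real assume "e > 0"
      then obtain d where d: "d \<in> I" "\<forall>j\<in>I. le d j \<longrightarrow> norm (u j - l) < e"
        using l unfolding norm_null_def by blast
      obtain j where j: "j \<in> I" "le d j" "le a' j" using directed_set_ub[OF I d(1) a(2)] .
      have "le a i" using directed_set_trans[OF I c(2) i(2)] a c i by blast
      then have "\<bar>u i - u j\<bar> \<le> z b" using a(3)[rule_format, of "(i, j)"] i j by simp
      moreover have "\<bar>u i - l\<bar> \<le> \<bar>u i - u j\<bar> + \<bar>u j - l\<bar>"
        using abs_triangle_ineq[of "u i - u j" "u j - l"] by simp
      ultimately have "\<bar>u i - l\<bar> \<le> z b + \<bar>u j - l\<bar>"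
        by (meson add_right_mono order_trans)
      moreover have "norm \<bar>u j - l\<bar> < e" using d j by simp
      ultimately show "\<exists>c. \<bar>u i - l\<bar> \<le> z b + c \<and> norm c < e" by blast
    qed
    with c(1) show "\<exists>a\<in>I. \<forall>i\<in>I. le a i \<longrightarrow> \<bar>u i - l\<bar> \<le> z b" by blast
  qed
  then show ?thesis ..
qed

text \<open>
  A net that is not norm Cauchy makes a jump of norm at least \<open>e\<close> after every index. Following
  these jumps gives an increasing sequence that contradicts the KB property.
\<close>

lemma KB_space_increasing_net_norm_converges:
  fixes g :: "'i \<Rightarrow> 'a::banach_lattice"
  assumes KB: "KB_space TYPE('a)" and I: "directed_set I le"
    and mono: "\<And>i j. i \<in> I \<Longrightarrow> j \<in> I \<Longrightarrow> le i j \<Longrightarrow> g i \<le> g j"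
    and bdd: "bounded (g ` I)"
  shows "\<exists>l. norm_null I le (\<lambda>i. g i - l)"
proof (rule Cauchy_net_norm_converges[OF I], rule ccontr)
  fix e :: real assume e: "e > 0"
    and "\<not> (\<exists>i\<in>I. \<forall>j\<in>I. le i j \<longrightarrow> norm (g j - g i) < e)"
  then have "\<forall>i\<in>I. \<exists>j\<in>I. le i j \<and> \<not> norm (g j - g i) < e" by blast
  then obtain h where h: "\<And>i. i \<in> I \<Longrightarrow> h i \<in> I" "\<And>i. i \<in> I \<Longrightarrow> le i (h i)"
    "\<And>i. i \<in> I \<Longrightarrow> \<not> norm (g (h i) - g i) < e"
    by metis
  obtain i0 where i0: "i0 \<in> I" using I unfolding directed_set_def by blast
  define c where "c n = (h ^^ n) i0" for n
  have cI: "c n \<in> I" for n by (induction n) (auto simp: c_def i0 h)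
  have cS: "c (Suc n) = h (c n)" for n by (simp add: c_def)
  have "incseq (\<lambda>n. g (c n))"
    by (rule incseq_SucI) (use mono cI cS h in auto)
  moreover have "bounded (range (\<lambda>n. g (c n)))"
    by (rule bounded_subset[OF bdd]) (use cI in auto)
  ultimately have "convergent (\<lambda>n. g (c n))"
    using KB unfolding KB_space_def by blast
  then have "Cauchy (\<lambda>n. g (c n))" by (rule convergent_Cauchy)
  then obtain N where "\<forall>m\<ge>N. \<forall>n\<ge>N. norm (g (c m) - g (c n)) < e"
    using CauchyD[OF _ e] by blast
  then have "norm (g (c (Suc N)) - g (c N)) < e" by simp
  then show False using h(3)[OF cI[of N]] cS by simp
qed

text \<open>
  Each truncation \<open>inf (x i) y\<close> has an order limit \<open>L y\<close>. These limits are compatible,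
  \<open>inf (L w) y = L y\<close> for \<open>y \<le> w\<close>, so they form an increasing net indexed by the positive cone,
  and it inherits the norm bound of \<open>x\<close>. The KB property glues them to one element \<open>l\<close> with
  \<open>L y = inf l y\<close>. As the truncation at the level \<open>l + y\<close> controls \<open>inf \<bar>x i - l\<bar> y\<close>, the net
  uo-converges to \<open>l\<close>.
\<close>

lemma KB_space_uo_Cauchy_nonneg_uo_converges:
  fixes x :: "'i \<Rightarrow> 'a::banach_lattice"
  assumes oc: "order_continuous TYPE('a)" and KB: "KB_space TYPE('a)"
    and I: "directed_set I le" and bdd: "bounded (x ` I)" and Cauchy: "uo_Cauchy I le x"
    and nonneg: "\<And>i. i \<in> I \<Longrightarrow> 0 \<le> x i"
  shows "\<exists>l. uo_converges I le x l"
proof -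
  have "\<exists>l. order_converges I le (\<lambda>i. inf (x i) y) l" if y: "0 \<le> y" for y
  proof (rule order_Cauchy_imp_order_converges[OF oc I])
    have *: "order_converges (I \<times> I) (rel_prod le le)
        (\<lambda>p. inf \<bar>(case p of (i, j) \<Rightarrow> x i - x j) - 0\<bar> y) 0"
      using Cauchy y unfolding uo_Cauchy_def uo_converges_def by blast
    show "order_converges (I \<times> I) (rel_prod le le) (\<lambda>(i, j). inf (x i) y - inf (x j) y) 0"
    proof (rule order_converges_dominated[OF *])
      fix p assume "p \<in> I \<times> I"
      then obtain i j where ij: "p = (i, j)" "i \<in> I" "j \<in> I" by blast
      then have "\<bar>inf (x i) y - inf (x j) y\<bar> \<le> inf \<bar>x i - x j\<bar> y"
        by (intro abs_inf_diff_le_inf nonneg y)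
      also have "\<dots> \<le> \<bar>(inf \<bar>x i - x j\<bar> y)\<bar>" by (rule abs_ge_self)
      finally show "\<bar>(case p of (i, j) \<Rightarrow> inf (x i) y - inf (x j) y) - 0\<bar>
          \<le> \<bar>(inf \<bar>(case p of (i, j) \<Rightarrow> x i - x j) - 0\<bar> y) - 0\<bar>"
        using ij by simp
    qed
  qed
  then obtain L where L: "\<And>y. 0 \<le> y \<Longrightarrow> order_converges I le (\<lambda>i. inf (x i) y) (L y)"
    by metis
  have N: "norm_null I le (\<lambda>i. inf (x i) y - L y)" if "0 \<le> y" for y
    by (rule order_converges_imp_norm_null[OF oc L[OF that]])
  have compat: "inf (L w) y = L y" if yw: "0 \<le> y" "y \<le> w" for y w
  proof -
    have "norm_null I le (\<lambda>i. inf (x i) y - inf (L w) y)"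
    proof (rule norm_null_dominated[OF N])
      show "0 \<le> w" using yw by (rule order_trans)
      fix i
      have "inf (x i) y = inf (inf (x i) w) y"
        using yw(2) by (simp add: inf_assoc inf_absorb2)
      then show "norm (inf (x i) y - inf (L w) y) \<le> norm (inf (x i) w - L w)"
        using abs_inf_diff_le by (intro norm_mono_abs) simp
    qed
    then show ?thesis by (rule norm_null_limit_unique[OF I _ N[OF yw(1)]])
  qed
  have L0: "L 0 = 0"
  proof -
    have "norm_null I le (\<lambda>i. L 0)"
      by (rule norm_null_dominated[OF N[of 0]]) (simp_all add: nonneg inf_absorb2)
    then show ?thesis by (rule norm_null_const[OF I])
  qed
  obtain M where M: "\<And>i. i \<in> I \<Longrightarrow> norm (x i) \<le> M"
    using bdd unfolding bounded_iff by auto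
  have LM: "norm (L y) \<le> M" if y: "0 \<le> y" for y
  proof (rule field_le_epsilon)
    fix e :: real assume "e > 0"
    then obtain a where a: "a \<in> I" "\<forall>i\<in>I. le a i \<longrightarrow> norm (inf (x i) y - L y) < e"
      using N[OF y] unfolding norm_null_def by blast
    then have "norm (inf (x a) y - L y) < e" using directed_set_refl[OF I] by blast
    moreover have "norm (inf (x a) y) \<le> norm (x a)"
      using nonneg[OF a(1)] y by (intro norm_mono_nonneg) auto
    moreover have "norm (L y) \<le> norm (inf (x a) y) + norm (inf (x a) y - L y)"
      by (metis norm_minus_commute norm_triangle_sub)
    ultimately show "norm (L y) \<le> M + e" using M[OF a(1)] by linarith
  qed
  have pos: "directed_set {y::'a. 0 \<le> y} (\<le>)"
    unfolding directed_set_def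
  proof (intro conjI ballI impI)
    fix i j :: 'a assume "i \<in> {y. 0 \<le> y}" "j \<in> {y. 0 \<le> y}"
    then show "\<exists>k\<in>{y. 0 \<le> y}. i \<le> k \<and> j \<le> k"
      by (intro bexI[of _ "sup i j"]) (auto intro: le_supI1)
  qed auto
  have "\<exists>l. norm_null {y. 0 \<le> y} (\<le>) (\<lambda>y. L y - l)"
  proof (rule KB_space_increasing_net_norm_converges[OF KB pos])
    fix y w :: 'a assume "y \<in> {y. 0 \<le> y}" "y \<le> w"
    then show "L y \<le> L w" using compat[of y w] by (metis inf_le1 mem_Collect_eq)
  next
    show "bounded (L ` {y. 0 \<le> y})" using LM unfolding bounded_iff by blast
  qed
  then obtain l where l: "norm_null {y. 0 \<le> y} (\<le>) (\<lambda>y. L y - l)" ..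
  have Ll: "L y = inf l y" if y: "0 \<le> y" for y
  proof -
    have "norm (L y - inf l y) \<le> 0 + e" if "e > 0" for e
    proof -
      obtain a where a: "0 \<le> a" "\<forall>w. 0 \<le> w \<longrightarrow> a \<le> w \<longrightarrow> norm (L w - l) < e"
        using l \<open>e > 0\<close> unfolding norm_null_def by blast
      define w where "w = sup a y"
      have "norm (L w - l) < e" using a y unfolding w_def by (simp add: le_supI1)
      moreover have "norm (inf (L w) y - inf l y) \<le> norm (L w - l)"
        by (rule norm_mono_abs[OF abs_inf_diff_le])
      moreover have "inf (L w) y = L y" using compat y unfolding w_def by simp
      ultimately show ?thesis by simp
    qed
    then have "norm (L y - inf l y) \<le> 0" by (rule field_le_epsilon)
    then show ?thesis by (simp only: norm_le_zero_iff right_minus_eq)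
  qed
  have l0: "0 \<le> l" using Ll[of 0] L0 by (metis inf_le1 order_refl)
  have "uo_converges I le x l"
    unfolding uo_converges_def
  proof (intro allI impI)
    fix y :: 'a assume y: "0 \<le> y"
    have "L (l + y) = l" using Ll[of "l + y"] l0 y by (simp add: inf_absorb1)
    then have *: "order_converges I le (\<lambda>i. inf (x i) (l + y)) l"
      using L[of "l + y"] l0 y by simp
    show "order_converges I le (\<lambda>i. inf \<bar>x i - l\<bar> y) 0"
    proof (rule order_converges_dominated[OF *])
      fix i
      have "0 \<le> inf \<bar>x i - l\<bar> y" using y by simp
      then show "\<bar>(inf \<bar>x i - l\<bar> y) - 0\<bar> \<le> \<bar>inf (x i) (l + y) - l\<bar>"
        using inf_abs_diff_le_abs_inf_diff[of "x i" l y]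
        by (simp only: diff_0_right abs_of_nonneg)
    qed
  qed
  then show ?thesis ..
qed

lemma KB_space_uo_Cauchy_uo_converges:
  fixes x :: "'i \<Rightarrow> 'a::banach_lattice"
  assumes oc: "order_continuous TYPE('a)" and KB: "KB_space TYPE('a)"
    and I: "directed_set I le" and bdd: "bounded (x ` I)" and Cauchy: "uo_Cauchy I le x"
  shows "\<exists>l. uo_converges I le x l"
proof -
  have *: "\<exists>l. uo_converges I le (\<lambda>i. pprt (x' i)) l"
    if x': "uo_Cauchy I le x'" "\<And>i. norm (x' i) = norm (x i)" for x' :: "'i \<Rightarrow> 'a"
  proof (rule KB_space_uo_Cauchy_nonneg_uo_converges[OF oc KB I])
    show "uo_Cauchy I le (\<lambda>i. pprt (x' i))"
      by (rule uo_Cauchy_dominated[OF x'(1) abs_pprt_diff_le])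
    obtain M where "\<And>i. i \<in> I \<Longrightarrow> norm (x i) \<le> M"
      using bdd unfolding bounded_iff by auto
    then have "norm (pprt (x' i)) \<le> M" if "i \<in> I" for i
      using norm_pprt_le[of "x' i" "x' i"] x'(2)[of i] that by force
    then show "bounded ((\<lambda>i. pprt (x' i)) ` I)"
      unfolding bounded_iff by blast
  qed simp
  obtain p where p: "uo_converges I le (\<lambda>i. pprt (x i)) p"
    using *[OF Cauchy] by blast
  have "uo_Cauchy I le (\<lambda>i. - x i)"
    by (rule uo_Cauchy_dominated[OF Cauchy]) (simp add: abs_minus_commute)
  then obtain q where q: "uo_converges I le (\<lambda>i. pprt (- x i)) q"
    using * by fastforce
  have "pprt (x i) - pprt (- x i) = x i" for i
    using prts[of "x i"] by (simp add: pprt_neg)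
  then show ?thesis using uo_converges_diff[OF I p q] by auto
qed

section \<open>From uo-completeness to the KB property\<close>

text \<open>
  If \<open>w\<close> bounds \<open>x\<close>, then the differences \<open>u - x n\<close>, with \<open>u\<close> ranging over all upper bounds,
  decrease to zero: a lower bound \<open>t\<close> of them can be subtracted from upper bounds any number of
  times, so the multiples of \<open>t\<close> stay below \<open>w - x 0\<close>. Order continuity makes them small in norm.
\<close>

lemma order_continuous_bounded_incseq_convergent:
  fixes x :: "nat \<Rightarrow> 'a::banach_lattice"
  assumes oc: "order_continuous TYPE('a)" and inc: "incseq x" and w: "\<And>n. x n \<le> w"
  shows "convergent x"
proof -
  define U where "U = {u. \<forall>n. x n \<le> u}"
  let ?le = "rel_prod (\<ge>) (\<le>) :: 'a \<times> nat \<Rightarrow> 'a \<times> nat \<Rightarrow> bool"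
  let ?d = "\<lambda>p. fst p - x (snd p)"
  have wU: "w \<in> U" using w by (simp add: U_def)
  have "directed_set U (\<ge>)"
    unfolding directed_set_def
  proof (intro conjI ballI impI)
    fix i j assume "i \<in> U" "j \<in> U"
    then show "\<exists>k\<in>U. k \<le> i \<and> k \<le> j" by (intro bexI[of _ "inf i j"]) (auto simp: U_def)
  qed (use wU in auto)
  then have dir: "directed_set (U \<times> UNIV) ?le"
    by (rule directed_set_Times[OF _ directed_set_nat])
  have dec: "decreases_to_zero (U \<times> UNIV) ?le ?d"
    unfolding decreases_to_zero_def
  proof (intro conjI ballI impI allI)
    fix p q assume "?le p q"
    then show "?d q \<le> ?d p" by (auto simp: rel_prod_sel intro!: diff_mono incseqD[OF inc])
  next
    fix p :: "'a \<times> nat" assume "p \<in> U \<times> UNIV"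
    then show "0 \<le> ?d p" by (auto simp: U_def)
  next
    fix t assume t: "\<forall>p\<in>U \<times> UNIV. t \<le> ?d p"
    have "w - real k *\<^sub>R t \<in> U" for k :: nat
    proof (induction k)
      case (Suc k)
      have "t \<le> (w - real k *\<^sub>R t) - x n" for n
        using t Suc by auto
      then have "x n \<le> (w - real k *\<^sub>R t) - t" for n
        by (metis add.commute le_diff_eq)
      then show ?case by (simp add: U_def algebra_simps)
    qed (simp add: wU)
    then have "x 0 \<le> w - real k *\<^sub>R t" for k :: nat by (simp add: U_def)
    then have "real k *\<^sub>R t \<le> w - x 0" for k :: nat by (metis add.commute le_diff_eq)
    then show "t \<le> 0" by (rule le_zero_if_multiples_bounded)
  qed
  have "order_converges (U \<times> UNIV) ?le ?d 0"
  proof (rule order_convergesI[OF dir dec])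
    fix p assume p: "p \<in> U \<times> (UNIV :: nat set)"
    have "\<bar>?d q - 0\<bar> \<le> ?d p" if "q \<in> U \<times> UNIV" "?le p q" for q
    proof -
      have "?d q \<le> ?d p" "0 \<le> ?d q"
        using dec p that unfolding decreases_to_zero_def by blast+
      then show ?thesis by simp
    qed
    with p show "\<exists>p0\<in>U \<times> UNIV. \<forall>q\<in>U \<times> UNIV. ?le p0 q \<longrightarrow> \<bar>?d q - 0\<bar> \<le> ?d p" by blast
  qed
  then have nn: "norm_null (U \<times> UNIV) ?le ?d" by (rule order_continuousD[OF oc])
  have "Cauchy x"
  proof (rule CauchyI)
    fix e :: real assume "e > 0"
    then have "e / 2 > 0" by simp
    then obtain u N where u: "u \<in> U"
      "\<forall>q\<in>U \<times> UNIV. ?le (u, N) q \<longrightarrow> norm (?d q) < e / 2"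
      using nn unfolding norm_null_def by (metis SigmaE)
    have *: "norm (u - x n) < e / 2" if "n \<ge> N" for n
      using u(2)[rule_format, of "(u, n)"] u(1) that by (simp add: rel_prod_sel)
    have "norm (x m - x n) < e" if "m \<ge> N" "n \<ge> N" for m n
    proof -
      have "norm (x m - x n) \<le> norm (u - x n) + norm (u - x m)"
        using norm_triangle_ineq4[of "u - x n" "u - x m"] by simp
      then show ?thesis using *[OF that(1)] *[OF that(2)] by linarith
    qed
    then show "\<exists>M. \<forall>m\<ge>M. \<forall>n\<ge>M. norm (x m - x n) < e" by blast
  qed
  then show ?thesis by (rule Cauchy_convergent)
qed

text \<open>
  If every tail of a sequence climbs by almost \<open>v\<close> again, then the sequence climbs by almost
  \<open>k v\<close>. With the norm error per climb at most half the norm of \<open>v\<close>, the climbs outgrow any norm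
  bound unless \<open>v = 0\<close>.
\<close>

lemma norm_bounded_climb_eq_zero:
  fixes x :: "nat \<Rightarrow> 'a::banach_lattice"
  assumes bdd: "bounded (range x)" and v: "0 \<le> v"
    and climb: "\<And>m. \<exists>n. norm (pprt (v - (x n - x m))) \<le> norm v / 2"
  shows "v = 0"
proof (rule ccontr)
  assume "v \<noteq> 0"
  have *: "\<exists>n. norm (pprt (real k *\<^sub>R v - (x n - x 0))) \<le> real k * (norm v / 2)" for k
  proof (induction k)
    case 0
    show ?case by (intro exI[of _ 0]) simp
  next
    case (Suc k)
    then obtain m where m: "norm (pprt (real k *\<^sub>R v - (x m - x 0))) \<le> real k * (norm v / 2)" ..
    obtain n where n: "norm (pprt (v - (x n - x m))) \<le> norm v / 2" using climb by blast
    have "real (Suc k) *\<^sub>R v - (x n - x 0)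
        = (real k *\<^sub>R v - (x m - x 0)) + (v - (x n - x m))"
      by (simp add: algebra_simps)
    then have "norm (pprt (real (Suc k) *\<^sub>R v - (x n - x 0)))
        \<le> norm (pprt (real k *\<^sub>R v - (x m - x 0)) + pprt (v - (x n - x m)))"
      by (intro norm_mono_nonneg) (simp_all only: zero_le_pprt pprt_add_le)
    also have "\<dots> \<le> real k * (norm v / 2) + norm v / 2"
      by (rule norm_triangle_mono[OF m n])
    also have "\<dots> = real (Suc k) * (norm v / 2)" by (simp add: algebra_simps)
    finally show ?case by blast
  qed
  obtain M where M: "\<And>n. norm (x n) \<le> M"
    using bdd unfolding bounded_iff by auto
  obtain k :: nat where k: "2 * M / (norm v / 2) < real k" using reals_Archimedean2 by blast
  obtain n where n: "norm (pprt (real k *\<^sub>R v - (x n - x 0))) \<le> real k * (norm v / 2)"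
    using * by blast
  let ?r = "pprt (real k *\<^sub>R v - (x n - x 0))"
  have "real k *\<^sub>R v - (x n - x 0) \<le> ?r" by (simp add: pprt_def)
  then have "real k *\<^sub>R v \<le> ?r + (x n - x 0)" by (simp only: diff_le_eq)
  moreover have "0 \<le> real k *\<^sub>R v" using v by (simp add: scaleR_nonneg_nonneg)
  ultimately have "norm (real k *\<^sub>R v) \<le> norm (?r + (x n - x 0))"
    by (intro norm_mono_nonneg)
  also have "\<dots> \<le> real k * (norm v / 2) + (M + M)"
  proof (rule norm_triangle_mono[OF n])
    show "norm (x n - x 0) \<le> M + M"
      using norm_triangle_ineq4[of "x n" "x 0"] M[of n] M[of 0] by linarith
  qed
  finally have "real k * (norm v / 2) \<le> 2 * M" by (simp add: field_simps)
  moreover have "2 * M < real k * (norm v / 2)"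
    using k \<open>v \<noteq> 0\<close> by (simp add: divide_simps split: if_splits)
  ultimately show False by linarith
qed

text \<open>
  For fixed \<open>y\<close> the truncated increments \<open>inf (x n - x m) y\<close> increase with \<open>n\<close> to a limit \<open>V m\<close>,
  which dominates \<open>inf \<bar>x i - x j\<bar> y\<close> for \<open>i, j \<ge> m\<close> and decreases in \<open>m\<close>. An element below all
  \<open>V m\<close> is almost climbed by \<open>x\<close> from every index on, so it vanishes.
\<close>

lemma norm_bounded_incseq_uo_Cauchy:
  fixes x :: "nat \<Rightarrow> 'a::banach_lattice"
  assumes oc: "order_continuous TYPE('a)" and bdd: "bounded (range x)" and inc: "incseq x"
  shows "uo_Cauchy UNIV (\<le>) x"
  unfolding uo_Cauchy_def uo_converges_def
proof (intro allI impI)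
  fix y :: 'a assume y: "0 \<le> y"
  have tinc: "incseq (\<lambda>n. inf (x n - x m) y)" for m
    by (intro incseq_SucI inf_mono diff_mono incseq_SucD[OF inc]) auto
  have "convergent (\<lambda>n. inf (x n - x m) y)" for m
    by (rule order_continuous_bounded_incseq_convergent[OF oc tinc]) (rule inf_le2)
  then obtain V where V: "\<And>m. (\<lambda>n. inf (x n - x m) y) \<longlonglongrightarrow> V m"
    unfolding convergent_def by metis
  have le_V: "inf (x n - x m) y \<le> V m" for m n
    by (rule incseq_le_norm_limit[OF tinc V])
  have V0: "0 \<le> V m" for m using le_V[of m m] y by (simp add: inf_absorb1)
  have approx: "\<exists>n. norm (V m - inf (x n - x m) y) < e" if "e > 0" for m e
    using LIMSEQ_D[OF V that] by (metis norm_minus_commute order_refl)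
  have Vdec: "V n \<le> V m" if "m \<le> n" for m n
  proof (rule le_if_approx_le)
    fix e :: real assume "e > 0"
    then obtain k where k: "norm (V n - inf (x k - x n) y) < e" using approx by blast
    have le: "inf (x k - x n) y \<le> inf (x k - x m) y"
      using that by (intro inf_mono diff_mono incseqD[OF inc]) auto
    have "V n = inf (x k - x n) y + (V n - inf (x k - x n) y)"
      by (simp only: add_diff_eq add_diff_cancel_left')
    also have "\<dots> \<le> V m + (V n - inf (x k - x n) y)"
      by (rule add_right_mono[OF order_trans[OF le le_V]])
    finally have "V n \<le> V m + (V n - inf (x k - x n) y)" .
    with k show "\<exists>c. V n \<le> V m + c \<and> norm c < e" by blast
  qed
  have null: "t \<le> 0" if t: "\<forall>m\<in>UNIV. t \<le> V m" for t
  proof -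
    let ?v = "pprt t"
    have vV: "?v \<le> V m" for m using t V0 by (simp add: pprt_def)
    have "?v = 0"
    proof (rule ccontr)
      assume nz: "?v \<noteq> 0"
      have "\<exists>n. norm (pprt (?v - (x n - x m))) \<le> norm ?v / 2" for m
      proof -
        obtain n where n: "norm (V m - inf (x n - x m) y) < norm ?v / 2"
          using approx[of "norm ?v / 2"] nz by auto
        have "?v - (x n - x m) \<le> V m - inf (x n - x m) y"
          by (intro diff_mono vV inf_le1)
        from norm_pprt_le[OF this] n show ?thesis by (intro exI[of _ n]) linarith
      qed
      then have "?v = 0" by (rule norm_bounded_climb_eq_zero[OF bdd zero_le_pprt])
      with nz show False ..
    qed
    then show ?thesis by (simp only: le_zero_iff_zero_pprt)
  qed
  have dec: "decreases_to_zero UNIV (\<le>) V"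
    unfolding decreases_to_zero_def by (intro conjI ballI allI impI V0 Vdec null) (assumption | erule (1) bspec)+
  show "order_converges (UNIV \<times> UNIV) (rel_prod (\<le>) (\<le>))
      (\<lambda>p. inf \<bar>(case p of (i, j) \<Rightarrow> x i - x j) - 0\<bar> y) 0"
  proof (rule order_convergesI[OF directed_set_nat dec])
    fix m :: nat
    have "inf \<bar>x i - x j\<bar> y \<le> V m" if "m \<le> i" "m \<le> j" for i j
    proof -
      have "\<bar>x i - x j\<bar> \<le> x (max i j) - x m"
      proof (rule abs_leI)
        show "x i - x j \<le> x (max i j) - x m"
          using that by (intro diff_mono incseqD[OF inc]) auto
        have "x j - x i \<le> x (max i j) - x m"
          using that by (intro diff_mono incseqD[OF inc]) auto
        then show "- (x i - x j) \<le> x (max i j) - x m" by (simp only: minus_diff_eq)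
      qed
      then have "inf \<bar>x i - x j\<bar> y \<le> inf (x (max i j) - x m) y" by (intro inf_mono) auto
      also have "\<dots> \<le> V m" by (rule le_V)
      finally show ?thesis .
    qed
    then have "\<bar>(inf \<bar>x i - x j\<bar> y)\<bar> \<le> V m" if "m \<le> i" "m \<le> j" for i j
      using y that by (simp add: abs_of_nonneg)
    then have "\<forall>q\<in>UNIV \<times> UNIV. rel_prod (\<le>) (\<le>) (m, m) q \<longrightarrow>
        \<bar>(inf \<bar>(case q of (i, j) \<Rightarrow> x i - x j) - 0\<bar> y) - 0\<bar> \<le> V m"
      by (simp add: split_paired_all)
    then show "\<exists>p\<in>UNIV \<times> UNIV. \<forall>q\<in>UNIV \<times> UNIV. rel_prod (\<le>) (\<le>) p q \<longrightarrow>
        \<bar>(inf \<bar>(case q of (i, j) \<Rightarrow> x i - x j) - 0\<bar> y) - 0\<bar> \<le> V m"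
      by blast
  qed
qed

text \<open>
  A uo-limit of an increasing sequence is an upper bound of it: the excess \<open>pprt (x m - l)\<close>, used
  as truncation level, stays below \<open>\<bar>x n - l\<bar>\<close> for all \<open>n \<ge> m\<close>, while order continuity drives
  the truncated distances to zero in norm. Then all distances are at most \<open>l - x 0\<close>, truncation at
  this level is vacuous, and order continuity gives norm convergence.
\<close>

lemma incseq_uo_converges_norm_converges:
  fixes x :: "nat \<Rightarrow> 'a::banach_lattice"
  assumes oc: "order_continuous TYPE('a)" and inc: "incseq x"
    and l: "uo_converges UNIV (\<le>) x l"
  shows "x \<longlonglongrightarrow> l"
proof -
  have N: "norm_null UNIV (\<le>) (\<lambda>n. inf \<bar>x n - l\<bar> y)" if "0 \<le> y" for y
    using l that order_continuousD[OF oc] unfolding uo_converges_def by blast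
  have le: "x m \<le> l" for m
  proof -
    let ?y = "pprt (x m - l)"
    have "norm ?y \<le> 0 + e" if "e > 0" for e
    proof -
      obtain a where a: "\<forall>n. a \<le> n \<longrightarrow> norm (inf \<bar>x n - l\<bar> ?y) < e"
        using N[of ?y] \<open>e > 0\<close> unfolding norm_null_def by auto
      define n where "n = max a m"
      have "x m - l \<le> x n - l" unfolding n_def by (intro diff_mono incseqD[OF inc]) auto
      then have "x m - l \<le> \<bar>x n - l\<bar>" using abs_ge_self order_trans by blast
      then have "?y \<le> \<bar>x n - l\<bar>" by (simp add: pprt_def)
      then have "inf \<bar>x n - l\<bar> ?y = ?y" by (rule inf_absorb2)
      then show ?thesis using a unfolding n_def by (metis add_0 less_imp_le max.cobounded1)
    qed
    then have "norm ?y \<le> 0" by (rule field_le_epsilon)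
    then have "x m - l \<le> 0" by (simp add: le_zero_iff_zero_pprt)
    then show ?thesis by simp
  qed
  have eq: "inf \<bar>x n - l\<bar> (l - x 0) = \<bar>x n - l\<bar>" for n
  proof (rule inf_absorb1)
    have "\<bar>x n - l\<bar> = l - x n" using le[of n] by simp
    also have "\<dots> \<le> l - x 0" by (intro diff_mono incseqD[OF inc]) auto
    finally show "\<bar>x n - l\<bar> \<le> l - x 0" .
  qed
  have "norm_null UNIV (\<le>) (\<lambda>n. \<bar>x n - l\<bar>)"
    using N[of "l - x 0"] le[of 0] unfolding eq by simp
  then show ?thesis unfolding norm_null_def by (auto intro!: LIMSEQ_I)
qed

section \<open>The equivalence\<close>

lemma uo_converges_image_iff:
  "uo_converges (f ` I) le x l \<longleftrightarrow> uo_converges I (\<lambda>i j. le (f i) (f j)) (\<lambda>i. x (f i)) l"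
  unfolding uo_converges_def order_converges_def by simp

lemma uo_Cauchy_image_iff:
  "uo_Cauchy (f ` I) le x \<longleftrightarrow> uo_Cauchy I (\<lambda>i j. le (f i) (f j)) (\<lambda>i. x (f i))"
proof -
  have "f ` I \<times> f ` I = map_prod f f ` (I \<times> I)" by auto
  then show ?thesis
    unfolding uo_Cauchy_def
    by (simp add: uo_converges_image_iff rel_prod_conv case_prod_unfold)
qed

(* Nets are indexed by directed subsets of 'i, an arbitrary infinite type; as 'i is universally
   quantified, the equivalences cover nets over every index set. 'i must be infinite so that it
   can index sequences: for finite 'i, every such net is trivially uo-convergent when uo-Cauchy. *)
theorem theorem4p7:
  assumes "order_continuous TYPE('a::banach_lattice)"
    and "infinite (UNIV :: 'i set)"
  shows "(KB_space TYPE('a) \<longleftrightarrow>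
            (\<forall>(I :: 'i set) le (x :: 'i \<Rightarrow> 'a).
               directed_set I le \<longrightarrow> bounded (x ` I) \<longrightarrow> uo_Cauchy I le x \<longrightarrow>
               (\<exists>l. uo_converges I le x l))) \<and>
         (KB_space TYPE('a) \<longleftrightarrow>
            (\<forall>x :: nat \<Rightarrow> 'a.
               bounded (range x) \<longrightarrow> uo_Cauchy UNIV (\<le>) x \<longrightarrow>
               (\<exists>l. uo_converges UNIV (\<le>) x l)))"
proof (intro conjI iffI allI impI)
  let ?seq = "\<forall>x :: nat \<Rightarrow> 'a. bounded (range x) \<longrightarrow> uo_Cauchy UNIV (\<le>) x \<longrightarrow>
    (\<exists>l. uo_converges UNIV (\<le>) x l)"
  have KB_if_seq: "KB_space TYPE('a)" if seq: ?seq
    unfolding KB_space_def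
  proof (intro allI impI)
    fix x :: "nat \<Rightarrow> 'a" assume x: "bounded (range x)" "incseq x"
    then obtain l where "uo_converges UNIV (\<le>) x l"
      using seq norm_bounded_incseq_uo_Cauchy[OF assms(1) x] by blast
    then show "convergent x"
      using incseq_uo_converges_norm_converges[OF assms(1) x(2)] unfolding convergent_def by blast
  qed
  then show "KB_space TYPE('a)" if ?seq using that .
  show "\<exists>l. uo_converges UNIV (\<le>) x l"
    if "KB_space TYPE('a)" "bounded (range x)" "uo_Cauchy UNIV (\<le>) x" for x :: "nat \<Rightarrow> 'a"
    using KB_space_uo_Cauchy_uo_converges[OF assms(1) that(1) directed_set_nat that(2,3)] .
  show "\<exists>l. uo_converges I le x l"
    if "KB_space TYPE('a)" "directed_set I le" "bounded (x ` I)" "uo_Cauchy I le x"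
    for I :: "'i set" and le and x :: "'i \<Rightarrow> 'a"
    using KB_space_uo_Cauchy_uo_converges[OF assms(1) that] .
  assume nets: "\<forall>(I :: 'i set) le (x :: 'i \<Rightarrow> 'a).
    directed_set I le \<longrightarrow> bounded (x ` I) \<longrightarrow> uo_Cauchy I le x \<longrightarrow> (\<exists>l. uo_converges I le x l)"
  obtain f :: "nat \<Rightarrow> 'i" where f: "inj f"
    using assms(2) infinite_countable_subset by blast
  show "KB_space TYPE('a)"
  proof (rule KB_if_seq, intro allI impI)
    fix x :: "nat \<Rightarrow> 'a" assume x: "bounded (range x)" "uo_Cauchy UNIV (\<le>) x"
    (* The sequence becomes a net over the range of f, with the order carried over from nat. *)
    let ?le = "\<lambda>i j. inv f i \<le> inv f j" and ?x = "\<lambda>i. x (inv f i)"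
    have "directed_set (range f) ?le"
      using directed_set_nat f unfolding directed_set_def by simp
    moreover have "bounded (?x ` range f)" using x(1) f by (simp add: image_image)
    moreover have "uo_Cauchy (range f) ?le ?x"
      using x(2) f by (simp add: uo_Cauchy_image_iff)
    ultimately obtain l where "uo_converges (range f) ?le ?x l" using nets by blast
    then show "\<exists>l. uo_converges UNIV (\<le>) x l"
      using f by (auto simp: uo_converges_image_iff)
  qed
qed

end
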